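(* Suppose the Wasserstein radius satisfies $\rho>0$. Then, for any $x\in\mathcal X$, $x$ satisfies the robust constraint $$\sum_{k=1}^{\hat K}\int_{\mathcal S}G(s,x)\,d\pi(\hat s_k,s)\ge\theta\qquad\forall\pi\in\mathcal D$$ if and only if there exists $\beta\in\mathbb R^{\hat K}\times\mathbb R_+$ such that $\sum_{k=1}^{\hat K}\hat w_k\beta_k-\rho\beta_{\hat K+1}\ge\theta$ and $$\beta_k-\beta_{\hat K+1}d_{\mathrm{BW}}^2(\mathcal N(\hat s_k),\mathcal N(s))\le G(s,x)\qquad\forall s\in\mathcal S,\ \forall k\in\{1,\dots,\hat K\}.$$ Consequently, the problem $$\text{(CDR)}\quad\min_{x\in\mathcal X}c^\top x\ \text{ s.t. }\ \sum_{k=1}^{\hat K}\int_{\mathcal S}G(s,x)\,d\pi(\hat s_k,s)\ge\theta\ \ \forall\pi\in\mathcal D$$ is equivalent to the semi-infinite program $$\text{(S-Inf)}\quad\min_{x\in\mathcal X,\ \beta\in\mathbb R^{\hat K}\times\mathbb R_+}c^\top x\ \text{ s.t. }\ \sum_{k=1}^{\hat K}\hat w_k\beta_k-\rho\beta_{\hat K+1}\ge\theta,\quad \beta_k-\beta_{\hat K+1}d_{\mathrm{BW}}^2(\mathcal N(\hat s_k),\mathcal N(s))\le G(s,x)\ \ \forall s\in\mathcal S,\ \forall k\in\{1,\dots,\hat K\}.$$ In particular, (CDR) and (S-Inf) have the same optimal objective value, and their optimal $x$-solutions coincide whenever an optimal solution exists.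
   Context: $\mathcal S=\Theta\times\Xi\subseteq\mathbb R^n\times\mathbb S^n_{\hat\delta}$ is compact, where $\hat\delta>0$ and $\mathbb S^n_{\hat\delta}$ is the set of symmetric matrices $Q\succeq\hat\delta I$. For $s=(m,Q)\in\mathcal S$, $\mathcal N(s)$ is the Gaussian law on $\mathbb R^n$ with mean $m$, covariance $Q$; for $s_i=(m_i,Q_i)$, $d_{\mathrm{BW}}^2(\mathcal N(s_1),\mathcal N(s_2))=\|m_1-m_2\|^2+\operatorname{tr}(Q_1+Q_2-2(Q_1^{1/2}Q_2Q_1^{1/2})^{1/2})$. The nominal distribution is the Gaussian mixture $\sum_{k=1}^{\hat K}\hat w_k\mathcal N(\hat s_k)$ with distinct $\hat s_1,\dots,\hat s_{\hat K}\in\mathcal S$, $\hat w_k\ge0$, $\sum_k\hat w_k=1$; $\hat{\mathcal S}=\{\hat s_1,\dots,\hat s_{\hat K}\}$. $\mathcal X\subset\mathbb R^n$ is compact, $c\in\mathbb R^n$, $b\in\mathbb R$, $\theta\in(0,1)$. For $s=(m,Q)$, $$G(s,x)=\Phi\Bigl(\frac{b-m^\top x}{\sqrt{x^\top Qx}}\Bigr)\ \text{ if }x\ne0,\qquad G(s,0)=1\text{ if }b\ge0,\quad G(s,0)=0\text{ if }b<0,$$ with $\Phi$ the standard normal CDF. $\mathcal D$ is the set of Borel probability measures $\pi$ on $\hat{\mathcal S}\times\mathcal S$ with $\pi(\{\hat s_k\}\times\mathcal S)=\hat w_k$ for all $k$ and $\int_{\hat{\mathcal S}\times\mathcal S}d_{\mathrm{BW}}^2(\mathcal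 N(\hat s),\mathcal N(s))\,d\pi(\hat s,s)\le\rho$; $d\pi(\hat s_k,s)$ denotes integration over $s$ against the measure $\pi(\{\hat s_k\}\times\cdot)$. The second marginal of $\pi$ is otherwise free. *)

theory Defs
  imports "HOL-Probability.Probability"
begin

text \<open>A pair \<open>(m, Q)\<close> stands for the Gaussian law with mean \<open>m\<close> and covariance \<open>Q\<close>.\<close>

type_synonym 'n param = "(real^'n) \<times> (real^'n^'n)"

definition psd :: "real^'n^'n \<Rightarrow> bool" where
  "psd A \<longleftrightarrow> transpose A = A \<and> (\<forall>v. 0 \<le> v \<bullet> (A *v v))"

text \<open>\<open>mat \<delta>\<close> is \<open>\<delta>\<close> times the identity matrix.\<close>

definition sym_ge :: "real \<Rightarrow> (real^'n^'n) set" where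
  "sym_ge \<delta> = {Q. transpose Q = Q \<and> psd (Q - mat \<delta>)}"

text \<open>The unique positive semidefinite square root; only meaningful if \<open>psd A\<close>.\<close>

definition psd_sqrt :: "real^'n^'n \<Rightarrow> real^'n^'n" where
  "psd_sqrt A = (THE B. psd B \<and> B ** B = A)"

text \<open>The squared Bures--Wasserstein distance of two Gaussian laws, in terms of their parameters.\<close>

fun bw_sq :: "'n::finite param \<Rightarrow> 'n param \<Rightarrow> real" where
  "bw_sq (m1, Q1) (m2, Q2) = (norm (m1 - m2))\<^sup>2 +
     trace (Q1 + Q2 - 2 *\<^sub>R psd_sqrt (psd_sqrt Q1 ** Q2 ** psd_sqrt Q1))"

text \<open>For \<open>\<xi>\<close> distributed according to \<open>(m, Q)\<close> with \<open>Q\<close> positive definite, this is the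
  probability of \<open>\<xi> \<bullet> x \<le> b\<close>.\<close>

fun chance :: "real \<Rightarrow> 'n::finite param \<Rightarrow> real^'n \<Rightarrow> real" where
  "chance b (m, Q) x =
     (if x \<noteq> 0 then cdf std_normal_distribution ((b - m \<bullet> x) / sqrt (x \<bullet> (Q *v x)))
      else if b \<ge> 0 then 1 else 0)"

text \<open>The Bochner integral of a non-integrable function is \<open>0\<close>; this does not matter here, because
  \<open>bw_sq\<close> is continuous on \<open>range shat \<times> S\<close> when \<open>S\<close> is a compact set of parameters with positive
  definite covariances.\<close>

definition ambiguity_set ::
  "real \<Rightarrow> real^'k \<Rightarrow> ('k \<Rightarrow> 'n param) \<Rightarrow> 'n::finite param set \<Rightarrow> ('n param \<times> 'n param) measure set"
where
  "ambiguity_set \<rho> w shat S = {\<pi>.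
     sets \<pi> = sets (restrict_space borel (range shat \<times> S)) \<and> prob_space \<pi> \<and>
     (\<forall>k. measure \<pi> ({shat k} \<times> S) = w $ k) \<and>
     (LINT z|\<pi>. bw_sq (fst z) (snd z)) \<le> \<rho>}"

text \<open>The measure \<open>A \<mapsto> \<pi> ({s0} \<times> A)\<close> on the Borel subsets of \<open>S\<close>.\<close>

definition slice ::
  "('n param \<times> 'n param) measure \<Rightarrow> 'n::finite param \<Rightarrow> 'n param set \<Rightarrow> 'n param measure"
where
  "slice \<pi> s0 S = distr (restrict_space \<pi> ({s0} \<times> S)) (restrict_space borel S) snd"

lemma emeasure_slice:
  assumes \<pi>: "sets \<pi> = sets (restrict_space borel (T \<times> S))"
    and "s0 \<in> T" and A: "A \<in> sets (restrict_space borel S)"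
  shows "emeasure (slice \<pi> s0 S) A = emeasure \<pi> ({s0} \<times> A)"
proof -
  have space: "space \<pi> = T \<times> S"
    using sets_eq_imp_space_eq[OF \<pi>] by (simp add: space_restrict_space)
  have meas: "snd \<in> measurable (restrict_space \<pi> ({s0} \<times> S)) (restrict_space borel S)"
  proof (rule measurable_restrict_space2)
    show "snd \<in> space (restrict_space \<pi> ({s0} \<times> S)) \<rightarrow> S"
      by (auto simp: space_restrict_space)
    have "snd \<in> measurable (restrict_space borel (T \<times> S)) borel"
      by (intro measurable_restrict_space1 borel_measurable_continuous_onI continuous_intros)
    then show "snd \<in> measurable (restrict_space \<pi> ({s0} \<times> S)) borel"
      using \<pi> by (intro measurable_restrict_space1) (simp cong: measurable_cong_sets)
  qed
  have AS: "A \<subseteq> S"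
    using A by (auto simp: sets_restrict_space)
  have "{s0} \<times> S = (({s0} \<times> UNIV) \<inter> (T \<times> S))"
    using \<open>s0 \<in> T\<close> by auto
  moreover have "closed ({s0} \<times> (UNIV :: 'a param set))"
    by (intro closed_Times) auto
  ultimately have "{s0} \<times> S \<in> sets \<pi>"
    unfolding \<pi> sets_restrict_space by (auto intro: image_eqI[of _ _ "{s0} \<times> UNIV"])
  moreover have "snd -` A \<inter> space (restrict_space \<pi> ({s0} \<times> S)) = {s0} \<times> A"
    using AS \<open>s0 \<in> T\<close> by (auto simp: space_restrict_space space)
  ultimately show ?thesis
    unfolding slice_def using A AS \<open>s0 \<in> T\<close>
    by (subst emeasure_distr[OF meas])
       (auto simp: space intro!: emeasure_restrict_space)
qed

definition robust ::
  "real \<Rightarrow> real \<Rightarrow> real \<Rightarrow> real^'k \<Rightarrow> ('k \<Rightarrow> 'n param) \<Rightarrow> 'n::finite param set \<Rightarrow> real^'n \<Rightarrow> bool"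
where
  "robust b \<theta> \<rho> w shat S x \<longleftrightarrow>
     (\<forall>\<pi> \<in> ambiguity_set \<rho> w shat S.
        (\<Sum>k\<in>UNIV. LINT s|slice \<pi> (shat k) S. chance b s x) \<ge> \<theta>)"

text \<open>A dual variable is a pair consisting of \<open>(\<beta>\<^sub>1, \<dots>, \<beta>\<^sub>K)\<close> and \<open>\<beta>\<^bsub>K+1\<^esub>\<close>, where \<open>K\<close> is
  the cardinality of the index type \<open>'k\<close>.\<close>

definition dual_feasible ::
  "real \<Rightarrow> real \<Rightarrow> real \<Rightarrow> real^'k \<Rightarrow> ('k \<Rightarrow> 'n param) \<Rightarrow> 'n::finite param set \<Rightarrow> real^'n
    \<Rightarrow> (real^'k) \<times> real \<Rightarrow> bool"
where
  "dual_feasible b \<theta> \<rho> w shat S x \<beta> \<longleftrightarrow>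
     (\<Sum>k\<in>UNIV. w $ k * fst \<beta> $ k) - \<rho> * snd \<beta> \<ge> \<theta> \<and>
     (\<forall>s\<in>S. \<forall>k. fst \<beta> $ k - snd \<beta> * bw_sq (shat k) s \<le> chance b s x)"

definition cdr_feasible ::
  "(real^'n) set \<Rightarrow> real \<Rightarrow> real \<Rightarrow> real \<Rightarrow> real^'k \<Rightarrow> ('k \<Rightarrow> 'n param) \<Rightarrow> 'n::finite param set
    \<Rightarrow> (real^'n) set"
where
  "cdr_feasible X b \<theta> \<rho> w shat S = {x \<in> X. robust b \<theta> \<rho> w shat S x}"

definition sinf_feasible ::
  "(real^'n) set \<Rightarrow> real \<Rightarrow> real \<Rightarrow> real \<Rightarrow> real^'k \<Rightarrow> ('k \<Rightarrow> 'n param) \<Rightarrow> 'n::finite param set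
    \<Rightarrow> ((real^'n) \<times> (real^'k) \<times> real) set"
where
  "sinf_feasible X b \<theta> \<rho> w shat S =
     {(x, \<beta>). x \<in> X \<and> \<beta> \<in> UNIV \<times> {0..} \<and> dual_feasible b \<theta> \<rho> w shat S x \<beta>}"

text \<open>The optimal value of a minimisation problem, \<open>\<infinity>\<close> if it is infeasible.\<close>

definition min_value :: "('a \<Rightarrow> real) \<Rightarrow> 'a set \<Rightarrow> ereal" where
  "min_value f F = (INF z\<in>F. ereal (f z))"

definition minimizers :: "('a \<Rightarrow> real) \<Rightarrow> 'a set \<Rightarrow> 'a set" where
  "minimizers f F = {z. is_arg_min f (\<lambda>z. z \<in> F) z}"

end

theory Submission
  imports Defs
begin

text \<open>
  The robust constraint is a linear program over transport plans with prescribed first marginal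
  and one further scalar constraint, the transport budget. The semi-infinite system is its dual,
  so the theorem is strong duality for this program: everything about optimal values and solutions
  follows because the feasible set of (CDR) is then the projection of that of (S-Inf).

  Weak duality is integration of the dual constraint against a plan \<open>\<pi>\<close> (\<open>weak_duality\<close>). The other
  direction (\<open>strong_duality_finite_mixtures\<close>) uses only plans with finite support. Such a plan is a
  mixture of deterministic transports, each moving \<open>shat k\<close> to a single point \<open>s k\<close>, so the pairs
  (cost, payoff) of these plans form the convex hull of the pairs of deterministic transports, a
  convex set in the plane. Robustness says that this set misses the quadrant
  \<open>{..\<rho>} \<times> {..<\<theta>}\<close>. A separating line has nonnegative coefficients because the quadrant is
  unbounded, and it is not vertical because \<open>\<rho> > 0\<close> and the transport that moves nothing has cost
  \<open>0\<close> (the Slater condition). Up to sign, its slope is the multiplier \<open>l\<close> of the budget, and the minimum of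
  payoff plus \<open>l\<close> times cost over \<open>S\<close> gives the multiplier of the \<open>k\<close>-th marginal constraint.

  The minima exist, and the integrals behave as expected, because cost and payoff are continuous
  on compact sets. For the Bures--Wasserstein cost this rests on the square root of positive definite
  matrices. Squaring is a continuous injection of the positive definite matrices into themselves.
  By invariance of domain its image is open, and by compactness of the preimages of compact sets it
  is closed, so it is everything (\<open>pd_has_root\<close>); the inverse is continuous for the same reason of
  compactness (\<open>continuous_on_psd_sqrt\<close>).
\<close>

section \<open>Square roots of positive definite matrices\<close>

definition pd :: "real^'n^'n \<Rightarrow> bool" where
  "pd A \<longleftrightarrow> transpose A = A \<and> (\<forall>v. v \<noteq> 0 \<longrightarrow> 0 < v \<bullet> (A *v v))"

lemma pd_imp_psd: "pd A \<Longrightarrow> psd A"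
  unfolding pd_def psd_def by (metis inner_zero_left order.refl less_imp_le)

lemma inner_symmetric_matrix:
  fixes A :: "real^'n^'n"
  assumes "transpose A = A"
  shows "(A *v u) \<bullet> v = u \<bullet> (A *v v)"
  using assms by (metis dot_lmul_matrix transpose_matrix_vector)

lemma matrix_mul_diff_ldistrib: "(A::real^'n^'m) ** (B - C) = A ** B - A ** C"
  by (simp add: matrix_matrix_mult_def vec_eq_iff sum_subtractf algebra_simps)

lemma matrix_mul_diff_rdistrib: "(A - B) ** (C::real^'n^'m) = A ** C - B ** C"
  by (simp add: matrix_matrix_mult_def vec_eq_iff sum_subtractf algebra_simps)

lemma continuous_on_matrix_mul [continuous_intros]:
  fixes f :: "'a::topological_space \<Rightarrow> real^'n^'m" and g :: "'a \<Rightarrow> real^'p^'n"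
  assumes "continuous_on T f" "continuous_on T g"
  shows "continuous_on T (\<lambda>x. f x ** g x)"
  unfolding matrix_matrix_mult_def using assms by (intro continuous_intros)

lemma continuous_on_matrix_vector_mul:
  fixes f :: "'a::topological_space \<Rightarrow> real^'n^'m" and g :: "'a \<Rightarrow> real^'n"
  assumes "continuous_on T f" "continuous_on T g"
  shows "continuous_on T (\<lambda>x. f x *v g x)"
  unfolding matrix_vector_mult_def using assms by (intro continuous_intros)

lemma continuous_on_trace [continuous_intros]:
  fixes f :: "'a::topological_space \<Rightarrow> real^'n^'n"
  assumes "continuous_on T f"
  shows "continuous_on T (\<lambda>x. trace (f x))"
  unfolding trace_def using assms by (intro continuous_intros)

lemma continuous_on_transpose:
  fixes f :: "'a::topological_space \<Rightarrow> real^'n^'m"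
  assumes "continuous_on T f"
  shows "continuous_on T (\<lambda>x. transpose (f x))"
  unfolding transpose_def using assms by (intro continuous_intros)

text \<open>If \<open>u = A v\<close> were nonzero, the form at \<open>v - t u\<close> would be \<open>- 2 t (u \<bullet> u) + O(t\<^sup>2)\<close>, which
  is negative for small \<open>t > 0\<close>.\<close>

lemma psd_isotropic_imp_kernel:
  fixes A :: "real^'n^'n"
  assumes A: "psd A" and v: "v \<bullet> (A *v v) = 0"
  shows "A *v v = 0"
proof (rule ccontr)
  define u where "u = A *v v"
  define a where "a = u \<bullet> u"
  define q where "q = u \<bullet> (A *v u)"
  \<comment> \<open>The minimizer is \<open>a / q\<close>; the shifted denominator also covers \<open>q = 0\<close>.\<close>
  define t where "t = a / (q + 1)"
  assume "A *v v \<noteq> 0"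
  then have a: "a > 0" by (simp add: a_def u_def)
  have q: "q \<ge> 0" using A by (simp add: psd_def q_def)
  have t: "t > 0" using a q by (simp add: t_def)
  have sym: "v \<bullet> (A *v u) = a"
    using A by (simp add: psd_def a_def u_def flip: inner_symmetric_matrix)
  have "0 \<le> (v - t *\<^sub>R u) \<bullet> (A *v (v - t *\<^sub>R u))"
    using A by (simp add: psd_def)
  also have "\<dots> = t * (t * q - 2 * a)"
    using v sym
    by (simp add: matrix_vector_mult_diff_distrib matrix_vector_mult_scaleR inner_diff_left
        inner_diff_right q_def a_def u_def[symmetric] algebra_simps)
  finally have "2 * a \<le> t * q"
    using t by (simp add: zero_le_mult_iff)
  moreover have "t * q \<le> a"
    using a q by (simp add: t_def field_simps)
  ultimately show False using a by linarith
qed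

text \<open>This upgrades the positive semidefinite root that the definition of \<open>psd_sqrt\<close> speaks of to a
  positive definite one, for which uniqueness is simpler: \<open>B v = 0\<close> would give \<open>B\<^sup>2 v = 0\<close>.\<close>

lemma pd_of_pd_square:
  fixes B :: "real^'n^'n"
  assumes B: "psd B" and BB: "pd (B ** B)"
  shows "pd B"
  unfolding pd_def
proof (intro conjI allI impI)
  show "transpose B = B" using B by (simp add: psd_def)
  fix v :: "real^'n" assume "v \<noteq> 0"
  then have "0 < v \<bullet> (B *v (B *v v))"
    using BB by (simp add: pd_def matrix_vector_mul_assoc)
  then have "v \<bullet> (B *v v) \<noteq> 0"
    using psd_isotropic_imp_kernel[OF B] by fastforce
  then show "0 < v \<bullet> (B *v v)"
    using B by (simp add: psd_def less_le)
qed

lemma pd_square: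
  fixes B :: "real^'n^'n"
  assumes B: "pd B"
  shows "pd (B ** B)"
  unfolding pd_def
proof (intro conjI allI impI)
  show "transpose (B ** B) = B ** B" using B by (simp add: pd_def matrix_transpose_mul)
  fix v :: "real^'n" assume "v \<noteq> 0"
  then have "B *v v \<noteq> 0" using B by (auto simp: pd_def)
  then have "0 < (B *v v) \<bullet> (B *v v)" by simp
  also have "\<dots> = v \<bullet> ((B ** B) *v v)"
    using B by (simp add: pd_def inner_symmetric_matrix[of B v] matrix_vector_mul_assoc)
  finally show "0 < v \<bullet> ((B ** B) *v v)" .
qed

lemma pd_congruence:
  fixes P Q :: "real^'n^'n"
  assumes P: "pd P" and Q: "pd Q"
  shows "pd (P ** Q ** P)"
  unfolding pd_def
proof (intro conjI allI impI)
  show "transpose (P ** Q ** P) = P ** Q ** P"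
    using P Q by (simp add: pd_def matrix_transpose_mul matrix_mul_assoc)
  fix v :: "real^'n" assume "v \<noteq> 0"
  then have "P *v v \<noteq> 0" using P by (auto simp: pd_def)
  then have "0 < (P *v v) \<bullet> (Q *v (P *v v))" using Q by (simp add: pd_def)
  then show "0 < v \<bullet> ((P ** Q ** P) *v v)"
    using P by (simp add: pd_def inner_symmetric_matrix matrix_vector_mul_assoc[symmetric])
qed

lemma inner_matrix_rows: "(A::real^'n^'m) \<bullet> B = (\<Sum>i\<in>UNIV. row i A \<bullet> row i B)"
  by (simp add: inner_vec_def row_def)

lemma inner_matrix_columns: "(A::real^'n^'m) \<bullet> B = (\<Sum>j\<in>UNIV. column j A \<bullet> column j B)"
  unfolding inner_vec_def column_def by (simp add: sum.swap[of _ "UNIV::'n set"])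

lemma row_matrix_mul: "row i ((A::real^'n^'m) ** B) = row i A v* B"
  by (simp add: row_def matrix_matrix_mult_def vector_matrix_mult_def vec_eq_iff mult.commute)

lemma column_matrix_mul: "column j ((A::real^'n^'m) ** B) = A *v column j B"
  by (simp add: column_def matrix_matrix_mult_def matrix_vector_mult_def vec_eq_iff)

text \<open>Equal squares give \<open>B D + D C = 0\<close> for \<open>D = B - C\<close>. Paired with \<open>D\<close>, both summands
  are nonnegative, being sums of values of the quadratic forms of \<open>B\<close> at the columns and of
  \<open>C\<close> at the rows of \<open>D\<close>.\<close>

lemma pd_eqI_square:
  fixes B C :: "real^'n^'n"
  assumes B: "pd B" and C: "pd C" and eq: "B ** B = C ** C"
  shows "B = C"
proof -
  define D where "D = B - C"
  have "B ** D + D ** C = 0"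
    using eq by (simp add: D_def matrix_mul_diff_ldistrib matrix_mul_diff_rdistrib)
  then have "D \<bullet> (B ** D) + D \<bullet> (D ** C) = 0"
    by (metis inner_add_right inner_zero_right)
  moreover have "D \<bullet> (D ** C) \<ge> 0"
  proof -
    have "row i D \<bullet> (row i D v* C) \<ge> 0" for i
      using pd_imp_psd[OF C] by (metis psd_def transpose_matrix_vector)
    then show ?thesis by (simp add: inner_matrix_rows row_matrix_mul sum_nonneg)
  qed
  moreover have nonneg: "column j D \<bullet> (B *v column j D) \<ge> 0" for j
    using pd_imp_psd[OF B] by (simp add: psd_def)
  moreover have BD: "D \<bullet> (B ** D) = (\<Sum>j\<in>UNIV. column j D \<bullet> (B *v column j D))"
    by (simp add: inner_matrix_columns column_matrix_mul)
  ultimately have "(\<Sum>j\<in>UNIV. column j D \<bullet> (B *v column j D)) = 0"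
    by (smt (verit) sum_nonneg)
  then have "column j D \<bullet> (B *v column j D) = 0" for j
    using nonneg by (simp add: sum_nonneg_eq_0_iff)
  then have "column j D = 0" for j
    using B by (metis less_irrefl pd_def)
  then have "D = 0" by (simp add: column_def vec_eq_iff)
  then show ?thesis by (simp add: D_def)
qed

text \<open>The norm on matrices is the Frobenius norm. Since it is determined by the square, a bound on
  squares bounds the roots.\<close>

lemma norm_square_symmetric_matrix:
  fixes B :: "real^'n^'n"
  assumes "transpose B = B"
  shows "(norm B)\<^sup>2 = trace (B ** B)"
proof -
  have "B $ i $ j = B $ j $ i" for i j
    using arg_cong[OF assms, of "\<lambda>M. M $ j $ i"] by (simp add: transpose_def)
  then show ?thesis
    unfolding power2_norm_eq_inner
    by (simp add: inner_vec_def trace_def matrix_matrix_mult_def)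
qed

lemma closed_psd: "closed {A::real^'n^'n. psd A}"
proof -
  have *: "{A::real^'n^'n. psd A} = {A. transpose A = A} \<inter> (\<Inter>v. {A. 0 \<le> v \<bullet> (A *v v)})"
    by (auto simp: psd_def)
  show ?thesis unfolding *
    by (intro closed_Int closed_INT ballI closed_Collect_eq closed_Collect_le continuous_intros
        continuous_on_transpose continuous_on_matrix_vector_mul)
qed

text \<open>Squaring is a proper map on the positive semidefinite matrices. This gives both the
  existence of roots and their continuous dependence on the matrix.\<close>

lemma compact_psd_square_preimage:
  fixes K :: "(real^'n^'n) set"
  assumes K: "compact K"
  shows "compact {B. psd B \<and> B ** B \<in> K}"
proof -
  have eq: "{B. psd B \<and> B ** B \<in> K} = {B. psd B} \<inter> (\<lambda>B. B ** B) -` K"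
    by auto
  have "closed {B. psd B \<and> B ** B \<in> K}"
    unfolding eq using K
    by (intro closed_Int closed_psd closed_vimage compact_imp_closed continuous_intros)
  moreover have "bounded {B. psd B \<and> B ** B \<in> K}"
  proof -
    have "compact (trace ` K)"
      using K by (intro compact_continuous_image continuous_intros)
    then have "bounded (trace ` K)" by (rule compact_imp_bounded)
    then obtain c where c: "\<And>A. A \<in> K \<Longrightarrow> \<bar>trace A\<bar> \<le> c"
      unfolding bounded_iff real_norm_def by blast
    have "norm B \<le> sqrt c" if "psd B" "B ** B \<in> K" for B
    proof -
      have "(norm B)\<^sup>2 \<le> c"
        using that c[of "B ** B"] by (simp add: norm_square_symmetric_matrix psd_def)
      then show ?thesis by (simp add: real_le_rsqrt)
    qed
    then show ?thesis unfolding bounded_iff by blast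
  qed
  ultimately show ?thesis by (simp add: compact_eq_bounded_closed)
qed

text \<open>By homogeneity it is enough to test unit vectors. The matrices that fail at some unit vector form
  the projection of a closed set along the compact sphere, hence a closed set.\<close>

lemma openin_pd: "openin (top_of_set {A. transpose A = A}) {A::real^'n^'n. pd A}"
proof -
  let ?C = "{A::real^'n^'n. \<exists>v. v \<in> sphere 0 1 \<and> (v, A) \<in> {p. fst p \<bullet> (snd p *v fst p) \<le> 0}}"
  have "closed {p::(real^'n) \<times> (real^'n^'n). fst p \<bullet> (snd p *v fst p) \<le> 0}"
    by (intro closed_Collect_le continuous_intros continuous_on_matrix_vector_mul)
  then have "closed ?C"
    by (intro closed_compact_projection) auto
  moreover have "{A. pd A} = {A. transpose A = A} \<inter> - ?C"
  proof (intro equalityI subsetI)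
    fix A :: "real^'n^'n" assume "A \<in> {A. pd A}"
    then show "A \<in> {A. transpose A = A} \<inter> - ?C"
      unfolding pd_def by (auto simp: not_le) (metis norm_zero zero_neq_one not_le)
  next
    fix A :: "real^'n^'n" assume A: "A \<in> {A. transpose A = A} \<inter> - ?C"
    then have unit: "0 < u \<bullet> (A *v u)" if "norm u = 1" for u
      using that by (auto simp: not_le)
    have "0 < v \<bullet> (A *v v)" if "v \<noteq> 0" for v
    proof -
      let ?u = "v /\<^sub>R norm v"
      have "norm ?u = 1" using that by simp
      then have "0 < ?u \<bullet> (A *v ?u)" by (rule unit)
      then show ?thesis
        using that by (simp add: matrix_vector_mult_scaleR zero_less_mult_iff)
    qed
    then show "A \<in> {A. pd A}" using A by (simp add: pd_def)
  qed
  ultimately show ?thesis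
    by (simp add: openin_open_Int open_Compl)
qed

lemma connected_pd: "connected {A::real^'n^'n. pd A}"
proof (rule convex_connected, rule convexI)
  fix A B :: "real^'n^'n" and u v :: real
  assume AB: "A \<in> {A. pd A}" "B \<in> {A. pd A}" and uv: "0 \<le> u" "0 \<le> v" "u + v = 1"
  have "transpose (u *\<^sub>R A + v *\<^sub>R B) = u *\<^sub>R A + v *\<^sub>R B"
    using AB by (simp add: pd_def transpose_def vec_eq_iff)
  moreover have "0 < x \<bullet> ((u *\<^sub>R A + v *\<^sub>R B) *v x)" if "x \<noteq> 0" for x
  proof -
    have "0 < x \<bullet> (A *v x)" "0 < x \<bullet> (B *v x)" using AB that by (auto simp: pd_def)
    moreover have "x \<bullet> ((u *\<^sub>R A + v *\<^sub>R B) *v x) = u * (x \<bullet> (A *v x)) + v * (x \<bullet> (B *v x))"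
      by (simp add: matrix_vector_mult_add_rdistrib scaleR_matrix_vector_assoc[symmetric]
          inner_add_right)
    ultimately show ?thesis using uv
      by (smt (verit) mult_nonneg_nonneg mult_pos_pos)
  qed
  ultimately show "u *\<^sub>R A + v *\<^sub>R B \<in> {A. pd A}" by (simp add: pd_def)
qed

lemma pd_mat_1: "pd (mat 1 :: real^'n^'n)"
  by (simp add: pd_def)

text \<open>The squares of positive definite matrices form a nonempty subset of the connected set of
  positive definite matrices that is open, by invariance of domain in the space of symmetric
  matrices, and closed, because squaring is proper.\<close>

lemma pd_has_root:
  fixes A :: "real^'n^'n"
  assumes "pd A"
  obtains B where "pd B" "B ** B = A"
proof -
  let ?P = "{A::real^'n^'n. pd A}" and ?sq = "\<lambda>B::real^'n^'n. B ** B"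
  let ?Sym = "{A::real^'n^'n. transpose A = A}"
  have sub: "?sq ` ?P \<subseteq> ?P" by (auto intro: pd_square)
  have PSym: "?P \<subseteq> ?Sym" by (auto simp: pd_def)
  have "openin (top_of_set ?Sym) (?sq ` ?P)"
  proof (rule invariance_of_domain_subspaces[OF openin_pd])
    show "subspace ?Sym"
      by (auto simp: subspace_def transpose_def vec_eq_iff)
    then show "subspace ?Sym" .
    show "continuous_on ?P ?sq" by (intro continuous_intros)
    show "?sq \<in> ?P \<rightarrow> ?Sym" using sub PSym by auto
    show "inj_on ?sq ?P" by (auto intro: inj_onI pd_eqI_square)
  qed simp
  then have "openin (top_of_set ?P) (?sq ` ?P)"
    by (rule openin_subset_trans[OF _ sub PSym])
  moreover have "closedin (top_of_set ?P) (?sq ` ?P)"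
    unfolding closedin_limpt
  proof (intro conjI allI impI sub)
    fix L :: "real^'n^'n"
    assume "L islimpt ?sq ` ?P \<and> L \<in> ?P"
    then obtain f where f: "(\<forall>n. f n \<in> ?sq ` ?P) \<and> L \<in> ?P \<and> f \<longlonglongrightarrow> L"
      unfolding islimpt_sequential by blast
    \<comment> \<open>Roots of the sequence stay in a compact set, so that \<open>L\<close> has a root at least in the
      positive semidefinite matrices.\<close>
    let ?K = "insert L (range f)"
    have "compact ?K" using f by (intro compact_sequence_with_limit) auto
    then have "compact (?sq ` {B. psd B \<and> B ** B \<in> ?K})"
      by (intro compact_continuous_image compact_psd_square_preimage continuous_intros)
    then have "closed (?sq ` {B. psd B \<and> B ** B \<in> ?K})" by (rule compact_imp_closed)
    moreover have "f n \<in> ?sq ` {B. psd B \<and> B ** B \<in> ?K}" for n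
    proof -
      obtain B where "pd B" "f n = B ** B" using f by blast
      moreover have "f n \<in> ?K" by simp
      ultimately show ?thesis using pd_imp_psd[of B] by (intro image_eqI[of _ _ B]) auto
    qed
    ultimately have "L \<in> ?sq ` {B. psd B \<and> B ** B \<in> ?K}"
      using f closed_sequentially by blast
    then show "L \<in> ?sq ` ?P"
      using f pd_of_pd_square by (clarsimp simp: image_iff) blast
  qed
  ultimately have "?sq ` ?P = {} \<or> ?sq ` ?P = ?P"
    using connected_pd unfolding connected_clopen by blast
  then have "?sq ` ?P = ?P"
    using pd_mat_1 by blast
  then have "A \<in> ?sq ` ?P" using assms by simp
  then show ?thesis using that by auto
qed

lemma psd_sqrt_eqI:
  fixes A B :: "real^'n^'n"
  assumes "pd B" "B ** B = A"
  shows "psd_sqrt A = B"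
  unfolding psd_sqrt_def
proof (rule the_equality)
  show "psd B \<and> B ** B = A" using assms pd_imp_psd by blast
  show "C = B" if "psd C \<and> C ** C = A" for C
    using assms that pd_of_pd_square pd_square pd_eqI_square by metis
qed

lemma psd_sqrt_pd:
  fixes A :: "real^'n^'n"
  assumes "pd A"
  shows "pd (psd_sqrt A)" "psd_sqrt A ** psd_sqrt A = A"
  using pd_has_root[OF assms] psd_sqrt_eqI by metis+

text \<open>A continuous injection on a compact set has a continuous inverse.\<close>

lemma continuous_on_psd_sqrt:
  fixes K :: "(real^'n^'n) set"
  assumes K: "compact K" "\<And>A. A \<in> K \<Longrightarrow> pd A"
  shows "continuous_on K psd_sqrt"
proof -
  let ?R = "{B. psd B \<and> B ** B \<in> K}"
  have "(\<lambda>B. B ** B) ` ?R = K"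
    using psd_sqrt_pd[OF K(2)] pd_imp_psd by (force intro!: image_eqI)
  moreover have "continuous_on ((\<lambda>B. B ** B) ` ?R) psd_sqrt"
  proof (rule continuous_on_inv)
    show "continuous_on ?R (\<lambda>B. B ** B)" by (intro continuous_intros)
    show "compact ?R" by (rule compact_psd_square_preimage[OF K(1)])
    show "\<forall>B\<in>?R. psd_sqrt (B ** B) = B"
      using K(2) pd_of_pd_square psd_sqrt_eqI by blast
  qed
  ultimately show ?thesis by simp
qed

section \<open>Continuity of the transport cost and of the chance function\<close>

lemma sym_ge_imp_pd:
  fixes Q :: "real^'n^'n"
  assumes "\<delta> > 0" "Q \<in> sym_ge \<delta>"
  shows "pd Q"
  unfolding pd_def
proof (intro conjI allI impI)
  show "transpose Q = Q" using assms by (simp add: sym_ge_def)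
  fix v :: "real^'n" assume "v \<noteq> 0"
  have "(mat \<delta> :: real^'n^'n) *v v = \<delta> *\<^sub>R v"
    by (simp add: matrix_vector_mult_def mat_def vec_eq_iff if_distrib[of "\<lambda>x. x * _"] cong: if_cong)
  moreover have "0 \<le> v \<bullet> ((Q - mat \<delta>) *v v)"
    using assms by (simp add: sym_ge_def psd_def)
  ultimately have "\<delta> * (v \<bullet> v) \<le> v \<bullet> (Q *v v)"
    by (simp add: matrix_vector_mult_diff_rdistrib inner_diff_right)
  moreover have "\<delta> * (v \<bullet> v) > 0" using assms \<open>v \<noteq> 0\<close> by simp
  ultimately show "0 < v \<bullet> (Q *v v)" by linarith
qed

text \<open>This makes the plan that moves nothing strictly feasible.\<close>

lemma bw_sq_self:
  assumes "pd (snd s)"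
  shows "bw_sq s s = 0"
proof -
  obtain m Q where s: "s = (m, Q)" by (cases s)
  have Q: "pd Q" using assms s by simp
  define R where "R = psd_sqrt Q"
  have R: "R ** R = Q" using psd_sqrt_pd[OF Q] by (simp add: R_def)
  have "R ** Q ** R = Q ** Q" by (simp add: matrix_mul_assoc flip: R)
  then have "psd_sqrt (R ** Q ** R) = Q" using psd_sqrt_eqI[OF Q] by simp
  moreover have "Q + Q - 2 *\<^sub>R Q = 0" by (simp add: vec_eq_iff)
  ultimately show ?thesis
    unfolding s R_def by (simp add: trace_0[unfolded mat_0])
qed

lemma continuous_on_bw_sq:
  fixes S :: "'n::finite param set"
  assumes S: "compact S" and pd: "\<And>s. s \<in> S \<Longrightarrow> pd (snd s)"
  shows "continuous_on (S \<times> S) (\<lambda>z. bw_sq (fst z) (snd z))"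
proof -
  let ?R = "\<lambda>z::'n param \<times> 'n param. psd_sqrt (snd (fst z))"
  let ?M = "\<lambda>z. ?R z ** snd (snd z) ** ?R z"
  have SS: "compact (S \<times> S)" using S by (simp add: compact_Times)
  have "compact (snd ` S)" using S by (intro compact_continuous_image continuous_intros)
  then have "continuous_on (snd ` S) psd_sqrt"
    using pd by (intro continuous_on_psd_sqrt) auto
  then have R: "continuous_on (S \<times> S) ?R"
    by (rule continuous_on_compose2) (auto intro!: continuous_intros)
  then have M: "continuous_on (S \<times> S) ?M" by (intro continuous_intros)
  have "continuous_on (?M ` (S \<times> S)) psd_sqrt"
  proof (rule continuous_on_psd_sqrt)
    show "compact (?M ` (S \<times> S))" by (rule compact_continuous_image[OF M SS])
    show "pd A" if "A \<in> ?M ` (S \<times> S)" for A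
      using that pd by (auto intro!: pd_congruence psd_sqrt_pd)
  qed
  then have "continuous_on (S \<times> S) (\<lambda>z. psd_sqrt (?M z))"
    by (rule continuous_on_compose2[OF _ M]) simp
  then have "continuous_on (S \<times> S) (\<lambda>z. (norm (fst (fst z) - fst (snd z)))\<^sup>2 +
     trace (snd (fst z) + snd (snd z) - 2 *\<^sub>R psd_sqrt (?M z)))"
    by (intro continuous_intros)
  moreover have "bw_sq (fst z) (snd z) = (norm (fst (fst z) - fst (snd z)))\<^sup>2 +
     trace (snd (fst z) + snd (snd z) - 2 *\<^sub>R psd_sqrt (?M z))" for z :: "'n param \<times> 'n param"
    by (cases z rule: prod.exhaust; cases "fst z"; cases "snd z") auto
  ultimately show ?thesis by simp
qed

lemma continuous_on_cdf_std_normal: "continuous_on UNIV (cdf std_normal_distribution)"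
proof -
  interpret real_distribution std_normal_distribution by (rule real_dist_normal_dist)
  have "measure std_normal_distribution {x} = 0" for x
    unfolding measure_def
    by (subst emeasure_density) (auto simp: nn_integral_indicator_singleton)
  then show ?thesis
    by (simp add: continuous_on_eq_continuous_at isCont_cdf)
qed

lemma continuous_on_chance:
  fixes S :: "'n::finite param set"
  assumes pd: "\<And>s. s \<in> S \<Longrightarrow> pd (snd s)"
  shows "continuous_on S (\<lambda>s. chance b s x)"
proof (cases "x = 0")
  case True
  then have "chance b s x = (if b \<ge> 0 then 1 else 0)" for s :: "'n param"
    by (cases s) simp
  then show ?thesis by simp
next
  case False
  have "continuous_on S (\<lambda>s. cdf std_normal_distribution
      ((b - fst s \<bullet> x) / sqrt (x \<bullet> (snd s *v x))))"
  proof (rule continuous_on_compose2[OF continuous_on_cdf_std_normal])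
    show "continuous_on S (\<lambda>s. (b - fst s \<bullet> x) / sqrt (x \<bullet> (snd s *v x)))"
      using pd False
      by (intro continuous_intros continuous_on_matrix_vector_mul) (fastforce simp: pd_def)
  qed simp
  moreover have "chance b s x = cdf std_normal_distribution
      ((b - fst s \<bullet> x) / sqrt (x \<bullet> (snd s *v x)))" for s :: "'n param"
    using False by (cases s) simp
  ultimately show ?thesis by simp
qed

section \<open>Transport plans\<close>

lemma strip_in_sets:
  fixes \<pi> :: "('n::finite param \<times> 'n param) measure"
  assumes \<pi>: "sets \<pi> = sets (restrict_space borel (T \<times> S))" and t: "t \<in> T"
  shows "{t} \<times> S \<in> sets \<pi>"
proof -
  have "{t} \<times> S = (T \<times> S) \<inter> ({t} \<times> UNIV)" using t by auto
  moreover have "closed ({t} \<times> (UNIV :: 'n param set))"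
    by (intro closed_Times) auto
  ultimately show ?thesis
    unfolding \<pi> sets_restrict_space by auto
qed

lemma borel_measurable_continuous_on_sets:
  fixes h :: "'a::topological_space \<Rightarrow> real"
  assumes \<pi>: "sets \<pi> = sets (restrict_space borel A)" and h: "continuous_on A h"
  shows "h \<in> borel_measurable \<pi>"
  using borel_measurable_continuous_on_restrict[OF h] \<pi> by (simp cong: measurable_cong_sets)

lemma integrable_continuous_on_compact:
  fixes h :: "'a::topological_space \<Rightarrow> real"
  assumes \<pi>: "sets \<pi> = sets (restrict_space borel A)" and "finite_measure \<pi>"
    and A: "compact A" and h: "continuous_on A h"
  shows "integrable \<pi> h"
proof -
  interpret finite_measure \<pi> by fact
  have space: "space \<pi> = A"
    using sets_eq_imp_space_eq[OF \<pi>] by (simp add: space_restrict_space)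
  have "bounded (h ` A)"
    using compact_continuous_image[OF h A] by (rule compact_imp_bounded)
  then obtain c where "\<And>x. x \<in> A \<Longrightarrow> norm (h x) \<le> c"
    unfolding bounded_iff by blast
  then show ?thesis
    using borel_measurable_continuous_on_sets[OF \<pi> h] space
    by (intro integrable_const_bound[of _ c]) auto
qed

text \<open>Integrals over a slice become integrals over the strip \<open>{t} \<times> S\<close> of the plan, so that all
  further computations take place under the single measure \<open>\<pi>\<close>.\<close>

lemma integral_slice:
  fixes \<pi> :: "('n::finite param \<times> 'n param) measure" and f :: "'n param \<Rightarrow> real"
  assumes \<pi>: "sets \<pi> = sets (restrict_space borel (T \<times> S))" and t: "t \<in> T"
    and f: "continuous_on S f"
  shows "(LINT s|slice \<pi> t S. f s) = (LINT z|\<pi>. indicator ({t} \<times> S) z * f (snd z))"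
proof -
  have "snd \<in> borel_measurable (restrict_space borel (T \<times> S))"
    by (intro borel_measurable_continuous_on_restrict continuous_intros)
  then have "snd \<in> borel_measurable (restrict_space \<pi> ({t} \<times> S))"
    using \<pi> by (intro measurable_restrict_space1) (simp cong: measurable_cong_sets)
  then have "snd \<in> measurable (restrict_space \<pi> ({t} \<times> S)) (restrict_space borel S)"
    by (intro measurable_restrict_space2) (auto simp: space_restrict_space)
  moreover have "f \<in> borel_measurable (restrict_space borel S)"
    using f by (rule borel_measurable_continuous_on_restrict)
  ultimately have "(LINT s|slice \<pi> t S. f s) = (LINT z|restrict_space \<pi> ({t} \<times> S). f (snd z))"
    unfolding slice_def by (rule integral_distr)
  also have "\<dots> = (LINT z|\<pi>. indicator ({t} \<times> S) z * f (snd z))"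
    using strip_in_sets[OF \<pi> t] by (subst integral_restrict_space) auto
  finally show ?thesis .
qed

text \<open>The strips \<open>{shat k} \<times> S\<close> partition the space of the plan, since \<open>shat\<close> is injective.
  Hence the worst-case constraint involves only the second marginal of the plan.\<close>

lemma sum_integral_slice:
  fixes \<pi> :: "('n::finite param \<times> 'n param) measure" and f :: "'n param \<Rightarrow> real"
    and shat :: "'k::finite \<Rightarrow> 'n param"
  assumes \<pi>: "sets \<pi> = sets (restrict_space borel (range shat \<times> S))" and "finite_measure \<pi>"
    and inj: "inj shat" and S: "compact S" and f: "continuous_on S f"
  shows "(\<Sum>k\<in>UNIV. LINT s|slice \<pi> (shat k) S. f s) = (LINT z|\<pi>. f (snd z))"
proof -
  let ?E = "\<lambda>k. {shat k} \<times> S"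
  have space: "space \<pi> = range shat \<times> S"
    using sets_eq_imp_space_eq[OF \<pi>] by (simp add: space_restrict_space)
  have fsnd: "integrable \<pi> (\<lambda>z. f (snd z))"
    using S by (intro integrable_continuous_on_compact[OF \<pi> \<open>finite_measure \<pi>\<close>]
        continuous_on_compose2[OF f] continuous_intros) (auto simp: compact_Times finite_imp_compact)
  have "(\<Sum>k\<in>UNIV. LINT s|slice \<pi> (shat k) S. f s)
      = (\<Sum>k\<in>UNIV. LINT z|\<pi>. indicator (?E k) z * f (snd z))"
    by (intro sum.cong integral_slice[OF \<pi> _ f]) auto
  also have "\<dots> = (LINT z|\<pi>. (\<Sum>k\<in>UNIV. indicator (?E k) z * f (snd z)))"
    using integrable_mult_indicator[OF strip_in_sets[OF \<pi>] fsnd]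
    by (intro Bochner_Integration.integral_sum[symmetric]) auto
  also have "\<dots> = (LINT z|\<pi>. f (snd z))"
  proof (rule Bochner_Integration.integral_cong[OF refl])
    fix z assume "z \<in> space \<pi>"
    then obtain j where "fst z = shat j" "snd z \<in> S" by (auto simp: space)
    then have "indicator (?E k) z = (if k = j then 1 else 0 :: real)" for k
      using inj by (cases z) (auto simp: indicator_def inj_eq)
    then show "(\<Sum>k\<in>UNIV. indicator (?E k) z * f (snd z)) = f (snd z)"
      by (simp add: if_distrib[of "\<lambda>x. x * _"] cong: if_cong)
  qed
  finally show ?thesis .
qed

text \<open>Integrate the dual constraint over the plan: on the strip of \<open>shat k\<close>, whose mass is \<open>w $ k\<close>,
  the constant \<open>\<beta> k\<close> contributes \<open>w $ k * \<beta> k\<close>, and the cost term integrates to at most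
  \<open>\<rho> * l\<close>.\<close>

lemma weak_duality:
  fixes shat :: "'k::finite \<Rightarrow> 'n::finite param" and w :: "real^'k"
  assumes \<pi>: "\<pi> \<in> ambiguity_set \<rho> w shat S"
    and inj: "inj shat" and S: "compact S"
    and d: "continuous_on (range shat \<times> S) (\<lambda>z. bw_sq (fst z) (snd z))"
    and g: "continuous_on S g" and l: "l \<ge> 0"
    and dual: "\<And>s k. s \<in> S \<Longrightarrow> \<beta> k - l * bw_sq (shat k) s \<le> g s"
  shows "(\<Sum>k\<in>UNIV. w $ k * \<beta> k) - \<rho> * l \<le> (LINT z|\<pi>. g (snd z))"
proof -
  let ?E = "\<lambda>k. {shat k} \<times> S"
  let ?b = "\<lambda>z. \<Sum>k\<in>UNIV. \<beta> k * indicator (?E k) z" and ?d = "\<lambda>z. bw_sq (fst z) (snd z)"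
  have sets: "sets \<pi> = sets (restrict_space borel (range shat \<times> S))"
    and "prob_space \<pi>" and marg: "\<And>k. measure \<pi> (?E k) = w $ k"
    and cost: "(LINT z|\<pi>. ?d z) \<le> \<rho>"
    using \<pi> by (auto simp: ambiguity_set_def)
  interpret prob_space \<pi> by fact
  have space: "space \<pi> = range shat \<times> S"
    using sets_eq_imp_space_eq[OF sets] by (simp add: space_restrict_space)
  have cpt: "compact (range shat \<times> S)"
    using S by (simp add: compact_Times finite_imp_compact)
  have E: "?E k \<in> sets \<pi>" for k by (intro strip_in_sets[OF sets]) auto
  have bint: "integrable \<pi> (\<lambda>z. \<beta> k * indicator (?E k) z)" for k
    using E[of k] by (intro integrable_mult_right) (simp add: less_top[symmetric])
  have dint: "integrable \<pi> ?d"
    by (rule integrable_continuous_on_compact[OF sets finite_measure_axioms cpt d])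
  have gint: "integrable \<pi> (\<lambda>z. g (snd z))"
    by (intro integrable_continuous_on_compact[OF sets finite_measure_axioms cpt]
        continuous_on_compose2[OF g] continuous_intros) auto
  have "(\<Sum>k\<in>UNIV. w $ k * \<beta> k) - \<rho> * l \<le> (\<Sum>k\<in>UNIV. w $ k * \<beta> k) - l * (LINT z|\<pi>. ?d z)"
    using mult_left_mono[OF cost l] by (simp add: mult.commute)
  \<comment> \<open>\<open>?b\<close> is the function with value \<open>\<beta> k\<close> on the strip of \<open>shat k\<close>.\<close>
  also have "\<dots> = (LINT z|\<pi>. ?b z - l * ?d z)"
  proof -
    have "(LINT z|\<pi>. ?b z) = (\<Sum>k\<in>UNIV. LINT z|\<pi>. \<beta> k * indicator (?E k) z)"
      by (intro Bochner_Integration.integral_sum bint)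
    also have "\<dots> = (\<Sum>k\<in>UNIV. w $ k * \<beta> k)"
      using E sets.sets_into_space[OF E]
      by (intro sum.cong refl) (simp add: marg Int_absorb2)
    moreover have "(LINT z|\<pi>. ?b z - l * ?d z) = (LINT z|\<pi>. ?b z) - (LINT z|\<pi>. l * ?d z)"
      using dint by (intro Bochner_Integration.integral_diff Bochner_Integration.integrable_sum bint) simp
    ultimately show ?thesis by simp
  qed
  also have "\<dots> \<le> (LINT z|\<pi>. g (snd z))"
  proof (intro integral_mono gint)
    show "integrable \<pi> (\<lambda>z. ?b z - l * ?d z)"
      using dint by (intro Bochner_Integration.integrable_diff Bochner_Integration.integrable_sum
          bint) simp
    fix z assume "z \<in> space \<pi>"
    then obtain j where j: "fst z = shat j" and z: "snd z \<in> S" by (auto simp: space)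
    then have "indicator (?E k) z = (if k = j then 1 else 0 :: real)" for k
      using inj by (cases z) (auto simp: indicator_def inj_eq)
    then have "?b z = (\<Sum>k\<in>UNIV. \<beta> k * (if k = j then 1 else 0))" by (simp only:)
    also have "\<dots> = \<beta> j" by (simp add: if_distrib cong: if_cong)
    finally have "?b z = \<beta> j" .
    then show "?b z - l * ?d z \<le> g (snd z)" using dual[OF z, of j] j by simp
  qed
  finally show ?thesis .
qed

lemma finite_weights_pmf:
  fixes v :: "'a \<Rightarrow> real"
  assumes J: "finite J" and v: "\<And>a. a \<in> J \<Longrightarrow> 0 \<le> v a" "sum v J = 1"
  shows "\<exists>p. \<forall>f :: 'a \<Rightarrow> real. (LINT a|measure_pmf p. f a) = (\<Sum>a\<in>J. v a * f a)"
proof -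
  let ?v = "\<lambda>a. if a \<in> J then v a else 0"
  have "(\<integral>\<^sup>+a. ennreal (?v a) \<partial>count_space UNIV) = (\<Sum>a\<in>J. ennreal (?v a))"
    using J by (intro nn_integral_count_space') auto
  also have "\<dots> = 1" using v by simp
  finally have pmf: "pmf (embed_pmf ?v) a = ?v a" for a
    using v by (intro pmf_embed_pmf) auto
  have "(LINT a|measure_pmf (embed_pmf ?v). f a) = (\<Sum>a\<in>J. v a * f a)" for f :: "'a \<Rightarrow> real"
    using J by (subst integral_measure_pmf[of J]) (auto simp: pmf set_pmf_eq split: if_splits)
  then show ?thesis by blast
qed

text \<open>A selection \<open>s :: 'k \<Rightarrow> 'n param\<close> describes the deterministic transport of \<open>shat k\<close> to
  \<open>s k\<close>. The plan draws a selection with probabilities \<open>u\<close> and, independently, an index with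
  probabilities \<open>w\<close>; each such mixture has the right first marginal.\<close>

lemma finite_mixture_plan:
  fixes shat :: "'k::finite \<Rightarrow> 'n::finite param" and w :: "real^'k"
    and J :: "('k \<Rightarrow> 'n param) set"
  assumes inj: "inj shat" and shat: "range shat \<subseteq> S"
    and w: "\<And>k. w $ k \<ge> 0" "(\<Sum>k\<in>UNIV. w $ k) = 1"
    and J: "finite J" "\<And>s k. s \<in> J \<Longrightarrow> s k \<in> S"
    and u: "\<And>s. s \<in> J \<Longrightarrow> 0 \<le> u s" "sum u J = 1"
  shows "\<exists>\<pi>. sets \<pi> = sets (restrict_space borel (range shat \<times> S)) \<and> prob_space \<pi> \<and>
    (\<forall>k. measure \<pi> ({shat k} \<times> S) = w $ k) \<and>
    (\<forall>h. continuous_on (range shat \<times> S) h \<longrightarrow>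
      (LINT z|\<pi>. h z) = (\<Sum>s\<in>J. u s * (\<Sum>k\<in>UNIV. w $ k * h (shat k, s k))))"
proof -
  let ?N = "restrict_space borel (range shat \<times> S)"
  \<comment> \<open>The map must stay in \<open>range shat \<times> S\<close> also at the selections of probability zero that
    leave \<open>S\<close>; there it takes the default value \<open>shat k\<close>.\<close>
  let ?T = "\<lambda>(s, k). (shat k, if s k \<in> S then s k else shat k)"
  let ?v = "\<lambda>(s, k). u s * w $ k"
  have fin: "finite (J \<times> (UNIV :: 'k set))" using J by simp
  have nonneg: "0 \<le> ?v a" if "a \<in> J \<times> UNIV" for a using that u w by auto
  have sum1: "sum ?v (J \<times> UNIV) = 1"
    using u w by (simp add: sum.cartesian_product[symmetric] sum_distrib_left[symmetric])
  from finite_weights_pmf[OF fin nonneg sum1]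
  obtain p where p: "\<forall>f :: ('k \<Rightarrow> 'n param) \<times> 'k \<Rightarrow> real.
      (LINT a|measure_pmf p. f a) = (\<Sum>a\<in>J \<times> UNIV. ?v a * f a)" ..
  define \<pi> where "\<pi> = distr (measure_pmf p) ?N ?T"
  have T: "?T \<in> measurable (measure_pmf p) ?N"
    using shat by (auto simp: space_restrict_space range_subsetD)
  have sets: "sets \<pi> = sets ?N" by (simp add: \<pi>_def)
  have int: "(LINT z|\<pi>. h z) = (\<Sum>s\<in>J. u s * (\<Sum>k\<in>UNIV. w $ k * h (shat k, s k)))"
    if "h \<in> borel_measurable ?N" for h
  proof -
    have "(LINT z|\<pi>. h z) = (\<Sum>a\<in>J \<times> UNIV. ?v a * h (?T a))"
      unfolding \<pi>_def using that by (simp add: integral_distr[OF T] p)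
    also have "\<dots> = (\<Sum>(s, k)\<in>J \<times> UNIV. u s * (w $ k * h (shat k, s k)))"
      using J by (intro sum.cong) (auto simp: mult.assoc)
    finally show ?thesis
      by (simp add: sum.cartesian_product[symmetric] sum_distrib_left)
  qed
  have "measure \<pi> ({shat k} \<times> S) = w $ k" for k
  proof -
    have E: "{shat k} \<times> S \<in> sets \<pi>" by (intro strip_in_sets[OF sets]) auto
    have "measure \<pi> ({shat k} \<times> S) = (LINT z|\<pi>. indicator ({shat k} \<times> S) z)"
      using sets.sets_into_space[OF E] by (simp add: Int_absorb2)
    also have "\<dots> = (\<Sum>s\<in>J. u s * (\<Sum>j\<in>UNIV. w $ j * indicator ({shat k} \<times> S) (shat j, s j)))"
      using E sets by (intro int) auto
    also have "\<dots> = (\<Sum>s\<in>J. u s * w $ k)"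
    proof (intro sum.cong refl)
      fix s assume "s \<in> J"
      then have "indicator ({shat k} \<times> S) (shat j, s j) = (if j = k then 1 else 0 :: real)" for j
        using inj J by (auto simp: indicator_def inj_eq)
      then have "(\<Sum>j\<in>UNIV. w $ j * indicator ({shat k} \<times> S) (shat j, s j))
          = (\<Sum>j\<in>UNIV. w $ j * (if j = k then 1 else 0))" by (simp only:)
      then show "u s * (\<Sum>j\<in>UNIV. w $ j * indicator ({shat k} \<times> S) (shat j, s j)) = u s * w $ k"
        by (simp add: if_distrib cong: if_cong)
    qed
    also have "\<dots> = w $ k" using u by (simp add: sum_distrib_right[symmetric])
    finally show ?thesis .
  qed
  moreover have "prob_space \<pi>"
    unfolding \<pi>_def by (rule measure_pmf.prob_space_distr[OF T])
  ultimately show ?thesis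
    using sets by (intro exI[of _ \<pi>] conjI allI impI int borel_measurable_continuous_on_restrict)
qed

section \<open>Strong duality\<close>

text \<open>Here \<open>d k s\<close> is the cost of moving the \<open>k\<close>-th atom to \<open>s\<close> and \<open>g s\<close> the payoff at \<open>s\<close>.
  The multipliers come from a line in the plane of pairs (cost, payoff) that separates the pairs of
  finite mixtures from those that respect the budget but miss the payoff \<open>\<theta>\<close>.\<close>

lemma strong_duality_finite_mixtures:
  fixes d :: "'k::finite \<Rightarrow> 'a \<Rightarrow> real" and g :: "'a \<Rightarrow> real" and w :: "'k \<Rightarrow> real"
  assumes slater: "\<And>k. s0 k \<in> S" "(\<Sum>k\<in>UNIV. w k * d k (s0 k)) < \<rho>"
    and attained: "\<And>l k. 0 \<le> l \<Longrightarrow> \<exists>s\<in>S. \<forall>t\<in>S. g s + l * d k s \<le> g t + l * d k t"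
    and primal: "\<And>J u. finite J \<Longrightarrow> (\<And>s k. s \<in> J \<Longrightarrow> s k \<in> S) \<Longrightarrow>
      (\<And>s. s \<in> J \<Longrightarrow> 0 \<le> u s) \<Longrightarrow> sum u J = 1 \<Longrightarrow>
      (\<Sum>s\<in>J. u s * (\<Sum>k\<in>UNIV. w k * d k (s k))) \<le> \<rho> \<Longrightarrow>
      \<theta> \<le> (\<Sum>s\<in>J. u s * (\<Sum>k\<in>UNIV. w k * g (s k)))"
  shows "\<exists>l \<beta>. 0 \<le> l \<and> \<theta> \<le> (\<Sum>k\<in>UNIV. w k * \<beta> k) - \<rho> * l \<and>
    (\<forall>s\<in>S. \<forall>k. \<beta> k - l * d k s \<le> g s)"
proof -
  define D where "D s = (\<Sum>k\<in>UNIV. w k * d k (s k))" for s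
  define G where "G s = (\<Sum>k\<in>UNIV. w k * g (s k))" for s
  let ?Sel = "{s. \<forall>k. s k \<in> S}" and ?F = "\<lambda>s. (D s, G s)"
  let ?C = "convex hull (?F ` ?Sel)" and ?B = "{..\<rho>} \<times> {..<\<theta>}"
  have "?B \<inter> ?C = {}"
  proof (rule ccontr)
    assume "?B \<inter> ?C \<noteq> {}"
    then obtain y where yB: "y \<in> ?B" and "y \<in> ?C" by blast
    then obtain T v where T: "finite T" "T \<subseteq> ?F ` ?Sel" and v: "\<And>x. x \<in> T \<Longrightarrow> 0 \<le> v x"
      "sum v T = 1" and y: "(\<Sum>x\<in>T. v x *\<^sub>R x) = y"
      unfolding convex_hull_explicit by blast
    obtain J where J: "J \<subseteq> ?Sel" "inj_on ?F J" "T = ?F ` J"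
      using T(2) by (auto simp: subset_image_inj)
    have "finite J" using T J by (simp add: finite_image_iff)
    have "sum (v \<circ> ?F) J = 1"
      using v(2) J by (simp add: sum.reindex)
    have yeq: "y = (\<Sum>s\<in>J. v (?F s) *\<^sub>R ?F s)"
      using y J by (simp add: sum.reindex)
    have "fst y = (\<Sum>s\<in>J. v (?F s) * D s)" "snd y = (\<Sum>s\<in>J. v (?F s) * G s)"
      unfolding yeq by (simp_all add: fst_sum snd_sum)
    moreover have "(\<Sum>s\<in>J. v (?F s) * D s) \<le> \<rho> \<Longrightarrow> \<theta> \<le> (\<Sum>s\<in>J. v (?F s) * G s)"
      using primal[of J "v \<circ> ?F"] \<open>finite J\<close> J v \<open>sum (v \<circ> ?F) J = 1\<close>
      by (auto simp: D_def G_def)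
    ultimately show False using yB by (cases y) auto
  qed
  moreover have "?F s0 \<in> ?C" using slater by (intro hull_inc) auto
  then have "?C \<noteq> {}" by blast
  moreover have "(\<rho>, \<theta> - 1) \<in> ?B" by simp
  then have "?B \<noteq> {}" by blast
  moreover have "convex ?B" by (intro convex_Times) auto
  ultimately have "\<exists>a c. a \<noteq> 0 \<and> (\<forall>x\<in>?B. a \<bullet> x \<le> c) \<and> (\<forall>x\<in>?C. a \<bullet> x \<ge> c)"
    by (intro separating_hyperplane_sets convex_convex_hull)
  then obtain a c where "a \<noteq> 0" and aB: "\<And>x. x \<in> ?B \<Longrightarrow> a \<bullet> x \<le> c"
    and aC: "\<And>x. x \<in> ?C \<Longrightarrow> c \<le> a \<bullet> x"
    by blast
  obtain a1 a2 where a: "a = (a1, a2)" by (cases a)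
  \<comment> \<open>The quadrant extends to minus infinity in both directions, which forces both coefficients of
    the line to be nonnegative: otherwise a far enough point violates the separation. The numbers
    \<open>(\<bar>r\<bar> + 1) / (- a1)\<close> and \<open>(\<bar>r\<bar> + 1) / (- a2)\<close> below are such distances.\<close>
  have B: "a1 * (\<rho> - t) + a2 * (\<theta> - e) \<le> c" if "0 \<le> t" "0 < e" for t e
    using aB[of "(\<rho> - t, \<theta> - e)"] that by (simp add: a)
  have C: "c \<le> a1 * D s + a2 * G s" if "\<And>k. s k \<in> S" for s
    using aC[of "?F s"] that by (auto simp: a intro: hull_inc)
  have a1: "a1 \<ge> 0"
  proof (rule ccontr)
    assume "\<not> a1 \<ge> 0"
    define r where "r = c - a1 * \<rho> - a2 * (\<theta> - 1)"
    have "a1 * (\<rho> - (\<bar>r\<bar> + 1) / (- a1)) = a1 * \<rho> + \<bar>r\<bar> + 1"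
      using \<open>\<not> a1 \<ge> 0\<close> by (simp add: field_simps)
    moreover have "(\<bar>r\<bar> + 1) / (- a1) \<ge> 0"
      using \<open>\<not> a1 \<ge> 0\<close> by (intro divide_nonneg_nonneg) auto
    ultimately show False
      using B[of "(\<bar>r\<bar> + 1) / (- a1)" 1] by (simp add: r_def)
  qed
  have a2: "a2 \<ge> 0"
  proof (rule ccontr)
    assume "\<not> a2 \<ge> 0"
    define r where "r = c - a1 * \<rho> - a2 * \<theta>"
    have "a2 * (\<theta> - (\<bar>r\<bar> + 1) / (- a2)) = a2 * \<theta> + \<bar>r\<bar> + 1"
      using \<open>\<not> a2 \<ge> 0\<close> by (simp add: field_simps)
    moreover have "(\<bar>r\<bar> + 1) / (- a2) > 0"
      using \<open>\<not> a2 \<ge> 0\<close> by (intro divide_pos_pos) auto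
    ultimately show False
      using B[of 0 "(\<bar>r\<bar> + 1) / (- a2)"] by (simp add: r_def)
  qed
  have corner: "a1 * \<rho> + a2 * \<theta> \<le> c"
  proof (rule field_le_epsilon)
    fix e :: real assume "0 < e"
    have "a2 * (e / (a2 + 1)) \<le> e"
      using a2 \<open>0 < e\<close> by (simp add: field_simps)
    moreover have "0 < e / (a2 + 1)" using a2 \<open>0 < e\<close> by simp
    ultimately show "a1 * \<rho> + a2 * \<theta> \<le> c + e"
      using B[of 0 "e / (a2 + 1)"] by (simp add: right_diff_distrib)
  qed
  \<comment> \<open>A vertical line would leave every cost at or above the budget, against the Slater point.\<close>
  have "a2 \<noteq> 0"
  proof
    assume "a2 = 0"
    then have "a1 > 0" using a1 \<open>a \<noteq> 0\<close> a by (auto simp: zero_prod_def)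
    then have "a1 * D s0 < a1 * \<rho>" using slater by (simp add: D_def)
    then show False using corner C[of s0] slater \<open>a2 = 0\<close> by simp
  qed
  then have a2: "a2 > 0" using a2 by simp
  define l where "l = a1 / a2"
  have l: "l \<ge> 0" using a1 a2 by (simp add: l_def)
  have main: "\<theta> + l * \<rho> \<le> G s + l * D s" if "\<And>k. s k \<in> S" for s
  proof -
    have "a1 * \<rho> + a2 * \<theta> \<le> a1 * D s + a2 * G s" using corner C[of s] that by simp
    then have "(a1 * \<rho> + a2 * \<theta>) / a2 \<le> (a1 * D s + a2 * G s) / a2"
      using a2 by (intro divide_right_mono) auto
    then show ?thesis using a2 by (simp add: l_def add_divide_distrib)
  qed
  \<comment> \<open>The Lagrangian separates over \<open>k\<close>; \<open>main\<close> at the selection of the minimizers is the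
    objective inequality of the dual.\<close>
  have "\<forall>k. \<exists>s\<in>S. \<forall>t\<in>S. g s + l * d k s \<le> g t + l * d k t"
    using attained[OF l] by blast
  then obtain s where s: "\<And>k. s k \<in> S"
    and min: "\<And>k t. t \<in> S \<Longrightarrow> g (s k) + l * d k (s k) \<le> g t + l * d k t"
    by metis
  define \<beta> where "\<beta> k = g (s k) + l * d k (s k)" for k
  have "(\<Sum>k\<in>UNIV. w k * \<beta> k) = G s + l * D s"
    by (simp add: \<beta>_def G_def D_def sum_distrib_left sum.distrib algebra_simps)
  then have "\<theta> \<le> (\<Sum>k\<in>UNIV. w k * \<beta> k) - \<rho> * l"
    using main[of s] s by (simp add: mult.commute)
  moreover have "\<beta> k - l * d k t \<le> g t" if "t \<in> S" for k t
    using min[OF that, of k] by (simp add: \<beta>_def)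
  ultimately show ?thesis using l by blast
qed

lemma robust_iff_dual_feasible:
  fixes S :: "'n::finite param set" and w :: "real^'k" and shat :: "'k::finite \<Rightarrow> 'n param"
  assumes S: "compact S" and pd: "\<And>s. s \<in> S \<Longrightarrow> pd (snd s)"
    and inj: "inj shat" and shat: "range shat \<subseteq> S"
    and w: "\<And>k. w $ k \<ge> 0" "(\<Sum>k\<in>UNIV. w $ k) = 1" and \<rho>: "\<rho> > 0"
  shows "robust b \<theta> \<rho> w shat S x \<longleftrightarrow>
    (\<exists>\<beta> \<in> UNIV \<times> {0..}. dual_feasible b \<theta> \<rho> w shat S x \<beta>)"
proof -
  let ?g = "\<lambda>s. chance b s x"
  have d: "continuous_on (range shat \<times> S) (\<lambda>z. bw_sq (fst z) (snd z))"
    using shat by (intro continuous_on_subset[OF continuous_on_bw_sq[OF S pd]]) auto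
  have g: "continuous_on S ?g" by (rule continuous_on_chance[OF pd])
  have payoff: "(\<Sum>k\<in>UNIV. LINT s|slice \<pi> (shat k) S. ?g s) = (LINT z|\<pi>. ?g (snd z))"
    if "sets \<pi> = sets (restrict_space borel (range shat \<times> S))" "prob_space \<pi>" for \<pi>
    using that S g inj by (intro sum_integral_slice) (auto intro: prob_space.finite_measure)
  show ?thesis
  proof
    assume R: "robust b \<theta> \<rho> w shat S x"
    have "\<exists>l \<beta>. 0 \<le> l \<and> \<theta> \<le> (\<Sum>k\<in>UNIV. w $ k * \<beta> k) - \<rho> * l \<and>
      (\<forall>s\<in>S. \<forall>k. \<beta> k - l * bw_sq (shat k) s \<le> ?g s)"
    proof (rule strong_duality_finite_mixtures[of shat S "($) w" "\<lambda>k. bw_sq (shat k)" \<rho> ?g \<theta>])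
      show "shat k \<in> S" for k using shat by auto
      then show "(\<Sum>k\<in>UNIV. w $ k * bw_sq (shat k) (shat k)) < \<rho>"
        using \<rho> by (simp add: bw_sq_self pd)
    next
      fix l :: real and k
      have "continuous_on S (\<lambda>s. bw_sq (shat k) s)"
        by (rule continuous_on_compose2[OF d, of S "Pair (shat k)", simplified])
          (auto intro!: continuous_intros)
      then have "continuous_on S (\<lambda>s. ?g s + l * bw_sq (shat k) s)"
        using g by (intro continuous_intros)
      moreover have "S \<noteq> {}" using shat by auto
      ultimately show "\<exists>s\<in>S. \<forall>t\<in>S. ?g s + l * bw_sq (shat k) s \<le> ?g t + l * bw_sq (shat k) t"
        using continuous_attains_inf[OF S] by blast
    next
      fix J :: "('k \<Rightarrow> 'n param) set" and u
      assume J: "finite J" "\<And>s k. s \<in> J \<Longrightarrow> s k \<in> S"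
        and u: "\<And>s. s \<in> J \<Longrightarrow> 0 \<le> u s" "sum u J = 1"
        and cost: "(\<Sum>s\<in>J. u s * (\<Sum>k\<in>UNIV. w $ k * bw_sq (shat k) (s k))) \<le> \<rho>"
      obtain \<pi> where \<pi>: "sets \<pi> = sets (restrict_space borel (range shat \<times> S))" "prob_space \<pi>"
        "\<And>k. measure \<pi> ({shat k} \<times> S) = w $ k"
        and int: "\<And>h. continuous_on (range shat \<times> S) h \<Longrightarrow>
          (LINT z|\<pi>. h z) = (\<Sum>s\<in>J. u s * (\<Sum>k\<in>UNIV. w $ k * h (shat k, s k)))"
        using finite_mixture_plan[of shat S w J u] inj shat w J u by auto
      have "\<pi> \<in> ambiguity_set \<rho> w shat S"
        using \<pi> cost by (simp add: ambiguity_set_def int[OF d])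
      then have "\<theta> \<le> (LINT z|\<pi>. ?g (snd z))"
        using R unfolding robust_def payoff[OF \<pi>(1,2), symmetric] by blast
      moreover have "continuous_on (range shat \<times> S) (\<lambda>z. ?g (snd z))"
        by (intro continuous_on_compose2[OF g] continuous_intros) auto
      ultimately show "\<theta> \<le> (\<Sum>s\<in>J. u s * (\<Sum>k\<in>UNIV. w $ k * ?g (s k)))"
        using int by simp
    qed
    then obtain l \<beta> where "0 \<le> l" "\<theta> \<le> (\<Sum>k\<in>UNIV. w $ k * \<beta> k) - \<rho> * l"
      "\<forall>s\<in>S. \<forall>k. \<beta> k - l * bw_sq (shat k) s \<le> ?g s" by blast
    then show "\<exists>\<beta> \<in> UNIV \<times> {0..}. dual_feasible b \<theta> \<rho> w shat S x \<beta>"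
      by (intro bexI[of _ "(\<chi> k. \<beta> k, l)"]) (auto simp: dual_feasible_def)
  next
    assume "\<exists>\<beta> \<in> UNIV \<times> {0..}. dual_feasible b \<theta> \<rho> w shat S x \<beta>"
    then obtain \<beta> l where l: "l \<ge> 0"
      and \<beta>: "\<theta> \<le> (\<Sum>k\<in>UNIV. w $ k * \<beta> $ k) - \<rho> * l"
        "\<And>s k. s \<in> S \<Longrightarrow> \<beta> $ k - l * bw_sq (shat k) s \<le> ?g s"
      by (auto simp: dual_feasible_def)
    show "robust b \<theta> \<rho> w shat S x"
      unfolding robust_def
    proof
      fix \<pi> assume \<pi>: "\<pi> \<in> ambiguity_set \<rho> w shat S"
      have "\<theta> \<le> (LINT z|\<pi>. ?g (snd z))"
        using weak_duality[OF \<pi> inj S d g l \<beta>(2)] \<beta>(1) by linarith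
      then show "\<theta> \<le> (\<Sum>k\<in>UNIV. LINT s|slice \<pi> (shat k) S. ?g s)"
        using \<pi> by (simp add: payoff ambiguity_set_def)
    qed
  qed
qed

lemma min_value_projection:
  "min_value f (fst ` F) = min_value (\<lambda>(x, y). f x) F"
  by (simp add: min_value_def image_image case_prod_beta)

lemma minimizers_projection:
  "minimizers f (fst ` F) = fst ` minimizers (\<lambda>(x, y). f x) F"
  by (force simp: minimizers_def is_arg_min_def image_iff)

theorem theorem4:
  fixes \<Theta> :: "(real^'n) set" and \<Xi> :: "(real^'n^'n) set" and S :: "'n::finite param set"
    and \<delta> \<rho> \<theta> b :: real and c :: "real^'n" and X :: "(real^'n) set"
    and w :: "real^'k" and shat :: "'k::finite \<Rightarrow> 'n param"
  assumes "\<delta> > 0" and "\<Xi> \<subseteq> sym_ge \<delta>" and "S = \<Theta> \<times> \<Xi>" and "compact S"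
    and "inj shat" and "range shat \<subseteq> S"
    and "\<forall>k. w $ k \<ge> 0" and "(\<Sum>k\<in>UNIV. w $ k) = 1"
    and "compact X" and "0 < \<theta>" and "\<theta> < 1"
    and "\<rho> > 0"
  shows "(\<forall>x\<in>X. robust b \<theta> \<rho> w shat S x \<longleftrightarrow>
            (\<exists>\<beta> \<in> UNIV \<times> {0..}. dual_feasible b \<theta> \<rho> w shat S x \<beta>))
    \<and> cdr_feasible X b \<theta> \<rho> w shat S = fst ` sinf_feasible X b \<theta> \<rho> w shat S
    \<and> min_value (\<lambda>x. c \<bullet> x) (cdr_feasible X b \<theta> \<rho> w shat S)
        = min_value (\<lambda>(x, \<beta>). c \<bullet> x) (sinf_feasible X b \<theta> \<rho> w shat S)
    \<and> minimizers (\<lambda>x. c \<bullet> x) (cdr_feasible X b \<theta> \<rho> w shat S)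
        = fst ` minimizers (\<lambda>(x, \<beta>). c \<bullet> x) (sinf_feasible X b \<theta> \<rho> w shat S)"
proof -
  have "pd (snd s)" if "s \<in> S" for s
    using \<open>\<Xi> \<subseteq> sym_ge \<delta>\<close> \<open>S = \<Theta> \<times> \<Xi>\<close> that by (intro sym_ge_imp_pd[OF \<open>\<delta> > 0\<close>]) auto
  then have equiv: "robust b \<theta> \<rho> w shat S x \<longleftrightarrow>
      (\<exists>\<beta> \<in> UNIV \<times> {0..}. dual_feasible b \<theta> \<rho> w shat S x \<beta>)" for x
    using assms by (intro robust_iff_dual_feasible) auto
  have "cdr_feasible X b \<theta> \<rho> w shat S = fst ` sinf_feasible X b \<theta> \<rho> w shat S"
    unfolding cdr_feasible_def sinf_feasible_def equiv by force
  then show ?thesis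
    using equiv by (simp only: min_value_projection minimizers_projection) blast
qed

end
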